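(* Let $k\ge1$ and let $\theta_k$ be the bound defined in the context. Then the step size $$\gamma_k=\min\left\{\max I_k,\ \frac{1}{\left(|\Delta\alpha_k|+\theta_k\|\Delta x_k\|\right)\|D_{k-1}^{-1}\|}\right\}$$ fulfils the condition $$\|E_k\|\,\|D_{k-1}^{-1}\|<1 .$$
   Context: $A\in\mathbb{R}^{m\times n}$, $b\in\mathbb{R}^m$ and $\varepsilon>0$ are given. $\|\cdot\|$ is the Euclidean norm for vectors and the induced (spectral) norm for matrices. The function $F=(F_1,F_2)$ is defined for $(x,\alpha)\in\mathbb{R}^n\times(0,\infty)$ by $$F_1(x,\alpha)=(A^TA+\alpha I)x-A^Tb,\qquad F_2(x,\alpha)=\tfrac12(Ax-b)^T(Ax-b)-\tfrac12\varepsilon^2 ,$$ with Jacobian $J(x,\alpha)=\begin{pmatrix}A^TA+\alpha I & x\\ (Ax-b)^TA & 0\end{pmatrix}$. Given the current iterate $(x_{k-1},\alpha_{k-1})\in\mathbb{R}^n\times(0,\infty)$, the Newton search direction $(\Delta x_k,\Delta\alpha_k)\in\mathbb{R}^n\times\mathbb{R}$ is the solution of $$J(x_{k-1},\alpha_{k-1})\begin{pmatrix}\Delta x_k\\ \Delta\alpha_k\end{pmatrix}=-F(x_{k-1},\alpha_{k-1}).$$ The iterates are generated by the scaled Newton iteration $x_k=x_{k-1}+\gamma_k\Delta x_k$, $\alpha_k=\alpha_{k-1}+\gamma_k\Delta\alpha_k$, started from a point $(x_0,\alpha_0)$ with $\alpha_0>0$ and $F_1(x_0,\alpha_0)=0$.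 A tolerance $\omega\in(0,1)$ is fixed and, in the following three cases only, the admissible set of step sizes $I_k$ and the number $\theta_k$ are defined by: - if $\Delta\alpha_k>0$: $I_k=(0,1]$ and $\theta_k=\sqrt2$; - if $\Delta\alpha_k<0$ and $\alpha_{k-1}+\Delta\alpha_k>0$: $I_k=(0,1]$ and $\theta_k=\sqrt{1+\left(\frac{\alpha_{k-1}}{\alpha_{k-1}+\Delta\alpha_k}\right)^2}$; - if $\Delta\alpha_k<0$ and $\alpha_{k-1}+\Delta\alpha_k<0$: $I_k=(0,-\omega\alpha_{k-1}/\Delta\alpha_k]$ and $\theta_k=\sqrt{1+\frac{1}{(1-\omega)^2}}$. With $\zeta_k=\alpha_{k-1}/(\alpha_{k-1}+\gamma_k\Delta\alpha_k)$, define the $(n+1)\times(n+1)$ matrices $$D_{k-1}=\begin{pmatrix}A^TA+\alpha_{k-1}I & x_{k-1}\\ -x_{k-1}^T & 0\end{pmatrix},\qquad E_k=\gamma_k\begin{pmatrix}\Delta\alpha_k I & \Delta x_k\\ -\zeta_k\Delta x_k^T & 0\end{pmatrix}.$$ It is a standing assumption that $x_{k-1}\neq0$, so that $D_{k-1}$ is invertible.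
   Formalization: For k > 1 the formal statement adds the assumption Δx_k ≠ 0; without it the strict inequality can fail, since the product equals 1 when Δx_k = 0 and the second term of the minimum is chosen (e.g. A=1, b=2, ε=3/2, x_0=α_0=1, γ_1=4/5, k=2). *)

theory Defs
  imports "HOL-Analysis.Analysis"
begin

text \<open>
  Vectors and matrices of size \<open>n + 1\<close> are indexed by \<open>'n + unit\<close>: the indices \<open>Inl i\<close> are the
  first \<open>n\<close> coordinates and \<open>Inr ()\<close> is the last one.
\<close>

definition stack :: "real ^ 'n \<Rightarrow> real \<Rightarrow> real ^ ('n::finite + unit)" where
  "stack v a = (\<chi> i. case i of Inl p \<Rightarrow> v $ p | Inr _ \<Rightarrow> a)"

text \<open>\<open>bordered M c r d\<close> has upper left block \<open>M\<close>, last column \<open>c\<close>, last row \<open>r\<close> and corner \<open>d\<close>.\<close>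

definition bordered ::
  "real ^ 'n ^ 'n \<Rightarrow> real ^ 'n \<Rightarrow> real ^ 'n \<Rightarrow> real \<Rightarrow> real ^ ('n::finite + unit) ^ ('n + unit)" where
  "bordered M c r d =
     (\<chi> i j. case i of
        Inl p \<Rightarrow> (case j of Inl q \<Rightarrow> M $ p $ q | Inr _ \<Rightarrow> c $ p)
      | Inr _ \<Rightarrow> (case j of Inl q \<Rightarrow> r $ q | Inr _ \<Rightarrow> d))"

text \<open>The instance of \<open>norm\<close> for type \<open>real ^ 'n ^ 'm\<close> is the Frobenius norm.\<close>

definition spectral_norm :: "real ^ 'n::finite ^ 'm::finite \<Rightarrow> real" where
  "spectral_norm M = onorm (\<lambda>v. M *v v)"

definition F1 :: "real ^ 'n::finite ^ 'm::finite \<Rightarrow> real ^ 'm \<Rightarrow> real ^ 'n \<Rightarrow> real \<Rightarrow> real ^ 'n" where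
  "F1 A b x \<alpha> = (transpose A ** A + \<alpha> *\<^sub>R mat 1) *v x - transpose A *v b"

definition F2 :: "real ^ 'n::finite ^ 'm::finite \<Rightarrow> real ^ 'm \<Rightarrow> real \<Rightarrow> real ^ 'n \<Rightarrow> real \<Rightarrow> real" where
  "F2 A b \<epsilon> x \<alpha> = 1 / 2 * ((A *v x - b) \<bullet> (A *v x - b)) - 1 / 2 * \<epsilon>\<^sup>2"

definition F ::
  "real ^ 'n::finite ^ 'm::finite \<Rightarrow> real ^ 'm \<Rightarrow> real \<Rightarrow> real ^ 'n \<Rightarrow> real \<Rightarrow> real ^ ('n + unit)" where
  "F A b \<epsilon> x \<alpha> = stack (F1 A b x \<alpha>) (F2 A b \<epsilon> x \<alpha>)"

definition J ::
  "real ^ 'n::finite ^ 'm::finite \<Rightarrow> real ^ 'm \<Rightarrow> real ^ 'n \<Rightarrow> real \<Rightarrow> real ^ ('n + unit) ^ ('n + unit)" where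
  "J A b x \<alpha> = bordered (transpose A ** A + \<alpha> *\<^sub>R mat 1) x ((A *v x - b) v* A) 0"

definition newton_direction ::
  "real ^ 'n::finite ^ 'm::finite \<Rightarrow> real ^ 'm \<Rightarrow> real \<Rightarrow> real ^ 'n \<Rightarrow> real \<Rightarrow> real ^ 'n \<Rightarrow> real \<Rightarrow> bool" where
  "newton_direction A b \<epsilon> x \<alpha> \<Delta>x \<Delta>\<alpha> \<longleftrightarrow> J A b x \<alpha> *v stack \<Delta>x \<Delta>\<alpha> = - F A b \<epsilon> x \<alpha>"

text \<open>
  The step sets and the bounds are given only in three cases, in terms of the current \<open>\<alpha>\<close> and the
  direction \<open>\<Delta>\<alpha>\<close>; their values in the remaining cases \<open>\<Delta>\<alpha> = 0\<close> and \<open>\<alpha> + \<Delta>\<alpha> = 0\<close> carry no meaning.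
\<close>

definition step_case :: "real \<Rightarrow> real \<Rightarrow> bool" where
  "step_case \<alpha> \<Delta>\<alpha> \<longleftrightarrow>
     \<Delta>\<alpha> > 0 \<or> (\<Delta>\<alpha> < 0 \<and> \<alpha> + \<Delta>\<alpha> > 0) \<or> (\<Delta>\<alpha> < 0 \<and> \<alpha> + \<Delta>\<alpha> < 0)"

definition step_set :: "real \<Rightarrow> real \<Rightarrow> real \<Rightarrow> real set" where
  "step_set \<omega> \<alpha> \<Delta>\<alpha> =
     (if \<Delta>\<alpha> > 0 then {0<..1}
      else if \<Delta>\<alpha> < 0 \<and> \<alpha> + \<Delta>\<alpha> > 0 then {0<..1}
      else if \<Delta>\<alpha> < 0 \<and> \<alpha> + \<Delta>\<alpha> < 0 then {0<..- \<omega> * \<alpha> / \<Delta>\<alpha>}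
      else undefined)"

definition theta :: "real \<Rightarrow> real \<Rightarrow> real \<Rightarrow> real" where
  "theta \<omega> \<alpha> \<Delta>\<alpha> =
     (if \<Delta>\<alpha> > 0 then sqrt 2
      else if \<Delta>\<alpha> < 0 \<and> \<alpha> + \<Delta>\<alpha> > 0 then sqrt (1 + (\<alpha> / (\<alpha> + \<Delta>\<alpha>))\<^sup>2)
      else if \<Delta>\<alpha> < 0 \<and> \<alpha> + \<Delta>\<alpha> < 0 then sqrt (1 + 1 / (1 - \<omega>)\<^sup>2)
      else undefined)"

definition D :: "real ^ 'n::finite ^ 'm::finite \<Rightarrow> real ^ 'n \<Rightarrow> real \<Rightarrow> real ^ ('n + unit) ^ ('n + unit)" where
  "D A x \<alpha> = bordered (transpose A ** A + \<alpha> *\<^sub>R mat 1) x (- x) 0"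

definition zeta :: "real \<Rightarrow> real \<Rightarrow> real \<Rightarrow> real" where
  "zeta \<alpha> \<gamma> \<Delta>\<alpha> = \<alpha> / (\<alpha> + \<gamma> * \<Delta>\<alpha>)"

definition E :: "real \<Rightarrow> real \<Rightarrow> real ^ 'n::finite \<Rightarrow> real \<Rightarrow> real ^ ('n + unit) ^ ('n + unit)" where
  "E \<alpha> \<gamma> \<Delta>x \<Delta>\<alpha> =
     \<gamma> *\<^sub>R bordered (\<Delta>\<alpha> *\<^sub>R mat 1) \<Delta>x (- (zeta \<alpha> \<gamma> \<Delta>\<alpha> *\<^sub>R \<Delta>x)) 0"

text \<open>
  \<open>Max\<close> is meaningful only for finite sets, so the largest element of a step set is expressed with
  \<open>GREATEST\<close>.
\<close>

definition step_size :: "real ^ 'n::finite ^ 'm::finite \<Rightarrow> real \<Rightarrow> real ^ 'n \<Rightarrow> real \<Rightarrow> real ^ 'n \<Rightarrow> real \<Rightarrow> real" where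
  "step_size A \<omega> x \<alpha> \<Delta>x \<Delta>\<alpha> =
     min (GREATEST s. s \<in> step_set \<omega> \<alpha> \<Delta>\<alpha>)
         (1 / ((\<bar>\<Delta>\<alpha>\<bar> + theta \<omega> \<alpha> \<Delta>\<alpha> * norm \<Delta>x) * spectral_norm (matrix_inv (D A x \<alpha>))))"

end

theory Submission
  imports Defs
begin

text \<open>
  Split \<open>E\<close> into its block diagonal part and its off-diagonal part. The first has norm
  \<open>\<gamma> \<bar>\<Delta>\<alpha>\<bar>\<close>. The second maps \<open>(u, a)\<close> to \<open>\<gamma> (a \<Delta>x, - \<zeta> (\<Delta>x \<bullet> u))\<close>, so it acts separately on the
  two components and has norm at most \<open>\<gamma> max 1 \<bar>\<zeta>\<bar> \<parallel>\<Delta>x\<parallel>\<close>. This gives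
  \<open>\<parallel>E\<parallel> \<le> \<gamma> (\<bar>\<Delta>\<alpha>\<bar> + max 1 \<bar>\<zeta>\<bar> \<parallel>\<Delta>x\<parallel>)\<close> (\<open>spectral_norm_skew_bordered_le\<close>).

  In each of the three cases \<open>\<theta> = sqrt (1 + z\<^sup>2)\<close>, where \<open>z\<close> bounds \<open>\<zeta>\<close> for every admissible step
  size. Hence \<open>max 1 \<zeta> < \<theta>\<close> strictly (\<open>zeta_less_theta\<close>), and the strictness is what is needed:
  the chosen \<open>\<gamma>\<close> only guarantees \<open>\<gamma> (\<bar>\<Delta>\<alpha>\<bar> + \<theta> \<parallel>\<Delta>x\<parallel>) \<parallel>D\<^sup>-\<^sup>1\<parallel> \<le> 1\<close>, with equality whenever the second
  term of the minimum is the smaller one.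

  The strict gap between \<open>max 1 \<zeta>\<close> and \<open>\<theta>\<close> survives the multiplication by \<open>\<parallel>\<Delta>x\<parallel>\<close> only if
  \<open>\<Delta>x \<noteq> 0\<close>. For \<open>k > 1\<close> this is a hypothesis; in the first step it follows from \<open>F1 = 0\<close> at the starting point: the upper
  Newton equation then reads \<open>(A\<^sup>T A + \<alpha> I) \<Delta>x = - \<Delta>\<alpha> x\<close>, and its right-hand side does not vanish,
  since \<open>x \<noteq> 0\<close> and all three cases exclude \<open>\<Delta>\<alpha> = 0\<close>
  (\<open>newton_direction_nonzero\<close>).
\<close>

section \<open>Vectors and matrices in block form\<close>

lemma sum_UNIV_Plus_unit:
  fixes f :: "'n::finite + unit \<Rightarrow> 'b::comm_monoid_add"
  shows "sum f UNIV = (\<Sum>i\<in>UNIV. f (Inl i)) + f (Inr ())"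
proof -
  have "sum f UNIV = sum f (UNIV <+> (UNIV :: unit set))"
    by simp
  also have "\<dots> = (\<Sum>i\<in>UNIV. f (Inl i)) + (\<Sum>i\<in>UNIV. f (Inr i))"
    by (subst sum.Plus) auto
  finally show ?thesis
    by (simp add: UNIV_unit)
qed

lemma stack_exhaust:
  obtains u a where "v = stack u a"
proof
  show "v = stack (\<chi> i. v $ Inl i) (v $ Inr ())"
    by (simp add: stack_def vec_eq_iff split: sum.split)
qed

lemma stack_eq_iff: "stack u a = stack u' a' \<longleftrightarrow> u = u' \<and> a = a'"
  by (auto simp: stack_def vec_eq_iff split: sum.split)

lemma stack_add: "stack u a + stack u' a' = stack (u + u') (a + a')"
  by (simp add: stack_def vec_eq_iff split: sum.split)

lemma minus_stack: "- stack u a = stack (- u) (- a)"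
  by (simp add: stack_def vec_eq_iff split: sum.split)

lemma norm_stack: "norm (stack u a) = sqrt ((norm u)\<^sup>2 + a\<^sup>2)"
proof -
  have "(norm (stack u a))\<^sup>2 = (norm u)\<^sup>2 + a\<^sup>2"
    unfolding power2_norm_eq_inner
    by (simp add: inner_vec_def sum_UNIV_Plus_unit stack_def power2_eq_square)
  then show ?thesis
    by (metis norm_ge_zero real_sqrt_unique)
qed

lemma bordered_mult_stack:
  "bordered M c r d *v stack u a = stack (M *v u + a *\<^sub>R c) (r \<bullet> u + d * a)"
  by (simp add: vec_eq_iff bordered_def stack_def matrix_vector_mult_def sum_UNIV_Plus_unit
      inner_vec_def mult.commute split: sum.split)

section \<open>The norm of the perturbation\<close>

lemma spectral_norm_nonneg: "0 \<le> spectral_norm M"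
  unfolding spectral_norm_def by (rule onorm_pos_le) (rule matrix_vector_mul_bounded_linear)

lemma spectral_norm_scaleR: "spectral_norm (c *\<^sub>R M) = \<bar>c\<bar> * spectral_norm M"
proof -
  have "(\<lambda>v. (c *\<^sub>R M) *v v) = (\<lambda>v. c *\<^sub>R (M *v v))"
    by (simp add: scaleR_matrix_vector_assoc)
  then show ?thesis
    unfolding spectral_norm_def by (simp only: onorm_scaleR matrix_vector_mul_bounded_linear)
qed

text \<open>
  The off-diagonal part sends the two components of its argument to separate components of its
  value, with factors at most \<open>\<parallel>p\<parallel>\<close> and \<open>\<bar>z\<bar> \<parallel>p\<parallel>\<close>; Pythagoras then yields the maximum of the two
  factors, whereas the triangle inequality would yield their sum.
\<close>

lemma spectral_norm_skew_bordered_le: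
  fixes p :: "real ^ 'n::finite"
  shows "spectral_norm (bordered (c *\<^sub>R mat 1) p (- (z *\<^sub>R p)) 0) \<le> \<bar>c\<bar> + max 1 \<bar>z\<bar> * norm p"
  unfolding spectral_norm_def
proof (rule onorm_bound)
  show "0 \<le> \<bar>c\<bar> + max 1 \<bar>z\<bar> * norm p"
    by (simp add: max_def)
next
  fix v :: "real ^ ('n + unit)"
  obtain u a where v: "v = stack u a"
    by (rule stack_exhaust)
  let ?m = "max 1 \<bar>z\<bar>"
  have split: "bordered (c *\<^sub>R mat 1) p (- (z *\<^sub>R p)) 0 *v v
      = stack (c *\<^sub>R u) 0 + stack (a *\<^sub>R p) (- (z * (p \<bullet> u)))"
    by (simp add: v bordered_mult_stack stack_add scaleR_matrix_vector_assoc [symmetric])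
  have diag: "norm (stack (c *\<^sub>R u) 0) \<le> \<bar>c\<bar> * norm v"
    by (simp add: v norm_stack mult_left_mono)
  have "norm (stack (a *\<^sub>R p) (- (z * (p \<bullet> u)))) \<le> sqrt ((?m * norm p)\<^sup>2 * ((norm u)\<^sup>2 + a\<^sup>2))"
    unfolding norm_stack
  proof (rule real_sqrt_le_mono)
    have "(norm (a *\<^sub>R p))\<^sup>2 \<le> (?m * (norm p * \<bar>a\<bar>))\<^sup>2"
    proof (rule power_mono)
      have "1 * (norm p * \<bar>a\<bar>) \<le> ?m * (norm p * \<bar>a\<bar>)"
        by (intro mult_right_mono) auto
      then show "norm (a *\<^sub>R p) \<le> ?m * (norm p * \<bar>a\<bar>)"
        by (simp add: mult.commute)
    qed simp
    moreover have "\<bar>- (z * (p \<bullet> u))\<bar>\<^sup>2 \<le> (?m * (norm p * norm u))\<^sup>2"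
    proof (rule power_mono)
      have "\<bar>z\<bar> * \<bar>p \<bullet> u\<bar> \<le> ?m * (norm p * norm u)"
        by (intro mult_mono Cauchy_Schwarz_ineq2) auto
      then show "\<bar>- (z * (p \<bullet> u))\<bar> \<le> ?m * (norm p * norm u)"
        by (simp add: abs_mult)
    qed simp
    ultimately show "(norm (a *\<^sub>R p))\<^sup>2 + (- (z * (p \<bullet> u)))\<^sup>2
        \<le> (?m * norm p)\<^sup>2 * ((norm u)\<^sup>2 + a\<^sup>2)"
      by (simp add: power_mult_distrib algebra_simps)
  qed
  also have "\<dots> = ?m * norm p * norm v"
    by (simp add: v norm_stack real_sqrt_mult max_def)
  finally have off: "norm (stack (a *\<^sub>R p) (- (z * (p \<bullet> u)))) \<le> ?m * norm p * norm v" .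
  show "norm (bordered (c *\<^sub>R mat 1) p (- (z *\<^sub>R p)) 0 *v v) \<le> (\<bar>c\<bar> + ?m * norm p) * norm v"
    unfolding split using norm_triangle_mono [OF diag off] by (simp add: distrib_right)
qed

lemma spectral_norm_E_le:
  "spectral_norm (E \<alpha> \<gamma> \<Delta>x \<Delta>\<alpha>) \<le> \<bar>\<gamma>\<bar> * (\<bar>\<Delta>\<alpha>\<bar> + max 1 \<bar>zeta \<alpha> \<gamma> \<Delta>\<alpha>\<bar> * norm \<Delta>x)"
  unfolding E_def spectral_norm_scaleR
  by (intro mult_left_mono spectral_norm_skew_bordered_le) simp

section \<open>Admissible step sizes\<close>

lemma Greatest_greaterThanAtMost:
  fixes a b :: "'a::linorder"
  assumes "a < b"
  shows "(GREATEST s. s \<in> {a<..b}) = b"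
  using assms by (intro Greatest_equality) auto

lemma Greatest_step_set_mem:
  assumes "0 < \<omega>" "0 < \<alpha>" "step_case \<alpha> \<Delta>\<alpha>"
  shows "(GREATEST s. s \<in> step_set \<omega> \<alpha> \<Delta>\<alpha>) \<in> step_set \<omega> \<alpha> \<Delta>\<alpha>"
proof -
  obtain c where "0 < c" "step_set \<omega> \<alpha> \<Delta>\<alpha> = {0<..c}"
  proof (cases "\<Delta>\<alpha> > 0 \<or> \<alpha> + \<Delta>\<alpha> > 0")
    case True
    with assms(3) show ?thesis
      by (intro that [of 1]) (auto simp: step_case_def step_set_def)
  next
    case False
    with assms show ?thesis
      by (intro that [of "- \<omega> * \<alpha> / \<Delta>\<alpha>"])
        (auto simp: step_case_def step_set_def divide_pos_neg mult_pos_pos)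
  qed
  then show ?thesis
    by (simp only: Greatest_greaterThanAtMost) simp
qed

lemma step_set_downward:
  assumes "step_case \<alpha> \<Delta>\<alpha>" "s \<in> step_set \<omega> \<alpha> \<Delta>\<alpha>" "0 < t" "t \<le> s"
  shows "t \<in> step_set \<omega> \<alpha> \<Delta>\<alpha>"
  using assms by (auto simp: step_case_def step_set_def split: if_splits)

text \<open>
  The updated \<open>\<alpha> + s \<Delta>\<alpha>\<close> is at least \<open>\<alpha>\<close>, \<open>\<alpha> + \<Delta>\<alpha>\<close> and \<open>(1 - \<omega>) \<alpha>\<close> in the three cases; this
  bounds \<open>\<zeta>\<close> by the number \<open>z\<close> with \<open>\<theta> = sqrt (1 + z\<^sup>2)\<close>, and both \<open>1\<close> and \<open>z > 0\<close> are strictly below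
  \<open>sqrt (1 + z\<^sup>2)\<close>.
\<close>

lemma zeta_less_theta:
  assumes "\<omega> < 1" "0 < \<alpha>" "step_case \<alpha> \<Delta>\<alpha>" "s \<in> step_set \<omega> \<alpha> \<Delta>\<alpha>"
  shows "max 1 \<bar>zeta \<alpha> s \<Delta>\<alpha>\<bar> < theta \<omega> \<alpha> \<Delta>\<alpha>"
proof -
  obtain l where l: "0 < l" "l \<le> \<alpha> + s * \<Delta>\<alpha>" "theta \<omega> \<alpha> \<Delta>\<alpha> = sqrt (1 + (\<alpha> / l)\<^sup>2)"
  proof -
    consider "\<Delta>\<alpha> > 0" | "\<Delta>\<alpha> < 0" "\<alpha> + \<Delta>\<alpha> > 0" | "\<Delta>\<alpha> < 0" "\<alpha> + \<Delta>\<alpha> < 0"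
      using assms(3) by (auto simp: step_case_def)
    then show ?thesis
    proof cases
      case 1
      with assms show ?thesis
        by (intro that [of \<alpha>]) (auto simp: step_set_def theta_def)
    next
      case 2
      with assms have "s \<le> 1"
        by (simp add: step_set_def)
      with 2 have "\<Delta>\<alpha> \<le> s * \<Delta>\<alpha>"
        by (simp add: mult_le_cancel_right2)
      with 2 show ?thesis
        by (intro that [of "\<alpha> + \<Delta>\<alpha>"]) (auto simp: theta_def)
    next
      case 3
      with assms have "s \<le> - \<omega> * \<alpha> / \<Delta>\<alpha>"
        by (simp add: step_set_def)
      with 3 have "- \<omega> * \<alpha> \<le> s * \<Delta>\<alpha>"
        by (simp add: field_simps)
      moreover have "theta \<omega> \<alpha> \<Delta>\<alpha> = sqrt (1 + (\<alpha> / ((1 - \<omega>) * \<alpha>))\<^sup>2)"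
        using 3 assms(2) by (simp add: theta_def power_divide)
      ultimately show ?thesis
        using assms(1,2) by (intro that [of "(1 - \<omega>) * \<alpha>"]) (simp_all add: left_diff_distrib)
    qed
  qed
  have "\<bar>zeta \<alpha> s \<Delta>\<alpha>\<bar> \<le> \<alpha> / l"
    using l assms(2) by (auto simp: zeta_def intro!: divide_left_mono)
  moreover have "\<alpha> / l < sqrt (1 + (\<alpha> / l)\<^sup>2)"
    by (rule real_less_rsqrt) simp
  moreover have "1 < sqrt (1 + (\<alpha> / l)\<^sup>2)"
    using l assms(2) by (intro real_less_rsqrt) simp
  ultimately show ?thesis
    using l(3) by simp
qed

section \<open>The step size condition\<close>

text \<open>
  A vanishing \<open>\<Delta>x\<close> would turn the upper Newton equation at a zero of \<open>F1\<close> into \<open>\<Delta>\<alpha> x = 0\<close>.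
\<close>

lemma newton_direction_nonzero:
  assumes "newton_direction A b \<epsilon> x \<alpha> \<Delta>x \<Delta>\<alpha>" "F1 A b x \<alpha> = 0" "x \<noteq> 0" "\<Delta>\<alpha> \<noteq> 0"
  shows "\<Delta>x \<noteq> 0"
  using assms
  by (auto simp: newton_direction_def J_def F_def bordered_mult_stack minus_stack stack_eq_iff)

text \<open>
  If \<open>matrix_inv (D A x \<alpha>)\<close> had norm zero, the second term of the minimum would be \<open>1 / 0 = 0\<close> and the
  step size would not be positive. The product vanishes then, so this case is split off.
\<close>

lemma step_size_condition:
  assumes "0 < \<omega>" "\<omega> < 1" "0 < \<alpha>" "step_case \<alpha> \<Delta>\<alpha>" "\<Delta>x \<noteq> 0"
    and \<gamma>: "\<gamma> = step_size A \<omega> x \<alpha> \<Delta>x \<Delta>\<alpha>"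
  shows "spectral_norm (E \<alpha> \<gamma> \<Delta>x \<Delta>\<alpha>) * spectral_norm (matrix_inv (D A x \<alpha>)) < 1"
proof (cases "spectral_norm (matrix_inv (D A x \<alpha>)) = 0")
  case True
  then show ?thesis
    by simp
next
  case False
  define N where "N = spectral_norm (matrix_inv (D A x \<alpha>))"
  define s where "s = (GREATEST s. s \<in> step_set \<omega> \<alpha> \<Delta>\<alpha>)"
  define \<theta> where "\<theta> = theta \<omega> \<alpha> \<Delta>\<alpha>"
  define e where "e = \<bar>\<Delta>\<alpha>\<bar> + \<theta> * norm \<Delta>x"
  have N: "0 < N"
    using False spectral_norm_nonneg [of "matrix_inv (D A x \<alpha>)"] by (simp add: N_def)
  have s: "s \<in> step_set \<omega> \<alpha> \<Delta>\<alpha>"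
    unfolding s_def using assms(1,3,4) by (rule Greatest_step_set_mem)
  then have "0 < s"
    using assms(4) by (auto simp: step_case_def step_set_def split: if_splits)
  have "0 < \<theta>"
    using zeta_less_theta [OF assms(2-4) s] by (simp add: \<theta>_def)
  then have e: "0 < e"
    using assms(5) by (simp add: e_def add_nonneg_pos)
  have \<gamma>_eq: "\<gamma> = min s (1 / (e * N))"
    by (simp add: \<gamma> step_size_def s_def e_def \<theta>_def N_def)
  then have "0 < \<gamma>"
    using \<open>0 < s\<close> e N by simp
  have "\<gamma> \<in> step_set \<omega> \<alpha> \<Delta>\<alpha>"
    using assms(4) s \<open>0 < \<gamma>\<close> by (rule step_set_downward) (simp add: \<gamma>_eq)
  then have "max 1 \<bar>zeta \<alpha> \<gamma> \<Delta>\<alpha>\<bar> < \<theta>"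
    unfolding \<theta>_def by (rule zeta_less_theta [OF assms(2-4)])
  then have "\<gamma> * (\<bar>\<Delta>\<alpha>\<bar> + max 1 \<bar>zeta \<alpha> \<gamma> \<Delta>\<alpha>\<bar> * norm \<Delta>x) < \<gamma> * e"
    unfolding e_def using \<open>0 < \<gamma>\<close> assms(5)
    by (intro mult_strict_left_mono add_strict_left_mono mult_strict_right_mono) auto
  then have "spectral_norm (E \<alpha> \<gamma> \<Delta>x \<Delta>\<alpha>) < \<gamma> * e"
    using spectral_norm_E_le [of \<alpha> \<gamma> \<Delta>x \<Delta>\<alpha>] \<open>0 < \<gamma>\<close> by (metis abs_of_pos le_less_trans)
  then have "spectral_norm (E \<alpha> \<gamma> \<Delta>x \<Delta>\<alpha>) * N < \<gamma> * e * N"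
    using N by simp
  also have "\<dots> \<le> 1 / (e * N) * (e * N)"
    unfolding mult.assoc using e N by (intro mult_right_mono) (simp_all add: \<gamma>_eq)
  also have "\<dots> = 1"
    using e N by simp
  finally show ?thesis
    by (simp add: N_def)
qed

theorem corollary2p8:
  fixes A :: "real ^ 'n::finite ^ 'm::finite" and b :: "real ^ 'm" and \<epsilon> \<omega> :: real
    and x \<Delta>x :: "nat \<Rightarrow> real ^ 'n" and \<alpha> \<Delta>\<alpha> \<gamma> :: "nat \<Rightarrow> real" and k :: nat
  assumes "\<epsilon> > 0" and "0 < \<omega>" and "\<omega> < 1"
    and "k \<ge> 1"
    and "F1 A b (x 0) (\<alpha> 0) = 0"
    and "\<And>j. j < k \<Longrightarrow> \<alpha> j > 0"
    and "\<And>j. j \<in> {1..k} \<Longrightarrow> newton_direction A b \<epsilon> (x (j - 1)) (\<alpha> (j - 1)) (\<Delta>x j) (\<Delta>\<alpha> j)"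
    and "\<And>j. j \<in> {1..k} \<Longrightarrow> x j = x (j - 1) + \<gamma> j *\<^sub>R \<Delta>x j"
    and "\<And>j. j \<in> {1..k} \<Longrightarrow> \<alpha> j = \<alpha> (j - 1) + \<gamma> j * \<Delta>\<alpha> j"
    and "x (k - 1) \<noteq> 0"
    and "k > 1 \<Longrightarrow> \<Delta>x k \<noteq> 0"
    and "step_case (\<alpha> (k - 1)) (\<Delta>\<alpha> k)"
    and "\<gamma> k = step_size A \<omega> (x (k - 1)) (\<alpha> (k - 1)) (\<Delta>x k) (\<Delta>\<alpha> k)"
  shows "spectral_norm (E (\<alpha> (k - 1)) (\<gamma> k) (\<Delta>x k) (\<Delta>\<alpha> k))
           * spectral_norm (matrix_inv (D A (x (k - 1)) (\<alpha> (k - 1)))) < 1"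
proof (rule step_size_condition)
  show "0 < \<omega>" "\<omega> < 1"
    by (fact assms)+
  show "0 < \<alpha> (k - 1)"
    using assms(4,6) by simp
  show "step_case (\<alpha> (k - 1)) (\<Delta>\<alpha> k)"
    by (fact assms)
  show "\<Delta>x k \<noteq> 0"
  proof (cases "k = 1")
    case True
    have "\<Delta>\<alpha> k \<noteq> 0"
      using assms(12) by (auto simp: step_case_def)
    with True assms(5,10) show ?thesis
      using newton_direction_nonzero [OF assms(7) [of k]] by simp
  next
    case False
    with assms(4,11) show ?thesis
      by simp
  qed
  show "\<gamma> k = step_size A \<omega> (x (k - 1)) (\<alpha> (k - 1)) (\<Delta>x k) (\<Delta>\<alpha> k)"
    by (fact assms)
qed

end
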